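(* Let $k$ be a field, $G$ a finite group, and let $V=\bigoplus_{g\in G}V_g$ and $W=\bigoplus_{g\in G}W_g$ be two $G$-graded twisted $k$-algebras (not necessarily associative or commutative). Fix bases $B_1=\{v_g\}$ of $V$ and $B_2=\{w_g\}$ of $W$ with $v_g\in V_g$, $w_g\in W_g$, and let $C_1,C_2:G\times G\to k^*$ be the associated structure constants. Then $V$ is isomorphic to $W$ by a graded isomorphism if and only if the function $C_1C_2^{-1}$ is in the kernel of $d^2:C^2(G,k^* )\to C^3(G,k^* )$ and the class $[C_1C_2^{-1}]$ is trivial in $H^2(G,k^* )$.
   Context: A $G$-graded twisted $k$-algebra is a $k$-algebra $W$ (not necessarily commutative or associative) with a grading $W=\bigoplus_{g\in G}W_g$, $W_aW_b\subset W_{ab}$, such that each $W_g$ is one-dimensional over $k$, $w_aw_b\neq 0$ for all nonzero $w_a\in W_a$, $w_b\in W_b$, and $W$ has an identity element $1\in W_e$, where $e$ is the identity of $G$. For a basis $\{w_g\}$ with $w_g\in W_g$ and $w_e=1$, the structure constant is the function $C:G\times G\to k^*$ with $w_aw_b=C(a,b)w_{ab}$. A graded isomorphism $\phi:V\to W$ is a unital $k$-algebra isomorphism with $\phi(V_g)\subset W_g$ for all $g\in G$. $C^n(G,k^* )$ is the group of functions $G^n\to k^*$, with $k^*$ a trivial $G$-module; the differentials are $d^1\varphi(a,b)=\varphi(b)\varphi(ab)^{-1}\varphi(a)$ and $d^2C(a,b,c)=C(b,c)C(ab,c)^{-1}C(a,bc)C(a,b)^{-1}$, and $H^2(G,k^*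 )=\ker d^2/\operatorname{im} d^1$. *)

theory Defs
  imports
    "Jordan_Normal_Form.Missing_VectorSpace"
    "HOL-Algebra.Product_Groups"
begin

section \<open>Graded twisted algebras\<close>

text \<open>
  The record type \<^typ>\<open>('k, 'v) module\<close> has fields for a multiplication and a one, while the
  locale \<^locale>\<open>vectorspace\<close> puts no condition on them.  A not necessarily associative algebra
  is thus a vector space whose multiplication field is bilinear.
\<close>

locale nonassoc_algebra = vectorspace K V for K and V +
  assumes alg_closed:
      "\<lbrakk>x \<in> carrier V; y \<in> carrier V\<rbrakk> \<Longrightarrow> x \<otimes>\<^bsub>V\<^esub> y \<in> carrier V"
    and alg_l_distr:
      "\<lbrakk>x \<in> carrier V; y \<in> carrier V; z \<in> carrier V\<rbrakk>
        \<Longrightarrow> (x \<oplus>\<^bsub>V\<^esub> y) \<otimes>\<^bsub>V\<^esub> z = (x \<otimes>\<^bsub>V\<^esub> z) \<oplus>\<^bsub>V\<^esub> (y \<otimes>\<^bsub>V\<^esub> z)"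
    and alg_r_distr:
      "\<lbrakk>x \<in> carrier V; y \<in> carrier V; z \<in> carrier V\<rbrakk>
        \<Longrightarrow> z \<otimes>\<^bsub>V\<^esub> (x \<oplus>\<^bsub>V\<^esub> y) = (z \<otimes>\<^bsub>V\<^esub> x) \<oplus>\<^bsub>V\<^esub> (z \<otimes>\<^bsub>V\<^esub> y)"
    and alg_smult_l:
      "\<lbrakk>c \<in> carrier K; x \<in> carrier V; y \<in> carrier V\<rbrakk>
        \<Longrightarrow> (c \<odot>\<^bsub>V\<^esub> x) \<otimes>\<^bsub>V\<^esub> y = c \<odot>\<^bsub>V\<^esub> (x \<otimes>\<^bsub>V\<^esub> y)"
    and alg_smult_r:
      "\<lbrakk>c \<in> carrier K; x \<in> carrier V; y \<in> carrier V\<rbrakk>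
        \<Longrightarrow> x \<otimes>\<^bsub>V\<^esub> (c \<odot>\<^bsub>V\<^esub> y) = c \<odot>\<^bsub>V\<^esub> (x \<otimes>\<^bsub>V\<^esub> y)"

text \<open>
  The direct sum over \<open>G\<close> is expressed by the unique decomposition into components; since \<open>G\<close> is
  finite, no condition on the support of the family \<open>f\<close> is needed.  In \<open>one_dimensional\<close>,
  finite dimensionality is required because \<open>dim\<close> is a \<open>LEAST\<close> and has no specified value otherwise.
\<close>

locale graded_twisted_algebra = group G + nonassoc_algebra K V
  for G :: "('g, 'm) monoid_scheme" and K :: "('k, 'l) ring_scheme"
    and V :: "('k, 'v, 'n) module_scheme" +
  fixes Vg :: "'g \<Rightarrow> 'v set"
  assumes finite_group: "finite (carrier G)"
    and component_subspace: "g \<in> carrier G \<Longrightarrow> subspace K (Vg g) V"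
    and direct_sum:
      "x \<in> carrier V \<Longrightarrow> \<exists>!f. f \<in> (\<Pi>\<^sub>E g\<in>carrier G. Vg g) \<and> x = (\<Oplus>\<^bsub>V\<^esub>g\<in>carrier G. f g)"
    and graded_mult:
      "\<lbrakk>a \<in> carrier G; b \<in> carrier G; x \<in> Vg a; y \<in> Vg b\<rbrakk>
        \<Longrightarrow> x \<otimes>\<^bsub>V\<^esub> y \<in> Vg (a \<otimes>\<^bsub>G\<^esub> b)"
    and one_dimensional:
      "g \<in> carrier G \<Longrightarrow> vectorspace.fin_dim K (vs (Vg g)) \<and> vectorspace.dim K (vs (Vg g)) = 1"
    and mult_nonzero:
      "\<lbrakk>a \<in> carrier G; b \<in> carrier G; x \<in> Vg a; y \<in> Vg b; x \<noteq> \<zero>\<^bsub>V\<^esub>; y \<noteq> \<zero>\<^bsub>V\<^esub>\<rbrakk>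
        \<Longrightarrow> x \<otimes>\<^bsub>V\<^esub> y \<noteq> \<zero>\<^bsub>V\<^esub>"
    and one_component: "\<one>\<^bsub>V\<^esub> \<in> Vg \<one>\<^bsub>G\<^esub>"
    and l_identity: "x \<in> carrier V \<Longrightarrow> \<one>\<^bsub>V\<^esub> \<otimes>\<^bsub>V\<^esub> x = x"
    and r_identity: "x \<in> carrier V \<Longrightarrow> x \<otimes>\<^bsub>V\<^esub> \<one>\<^bsub>V\<^esub> = x"

definition graded_isomorphism ::
  "('g, 'm) monoid_scheme \<Rightarrow> ('k, 'l) ring_scheme \<Rightarrow>
   ('k, 'v, 'n) module_scheme \<Rightarrow> ('g \<Rightarrow> 'v set) \<Rightarrow>
   ('k, 'w, 'p) module_scheme \<Rightarrow> ('g \<Rightarrow> 'w set) \<Rightarrow> ('v \<Rightarrow> 'w) \<Rightarrow> bool"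
  where "graded_isomorphism G K V Vg W Wg \<phi> \<longleftrightarrow>
    linear_map K V W \<phi> \<and>
    bij_betw \<phi> (carrier V) (carrier W) \<and>
    (\<forall>x\<in>carrier V. \<forall>y\<in>carrier V. \<phi> (x \<otimes>\<^bsub>V\<^esub> y) = \<phi> x \<otimes>\<^bsub>W\<^esub> \<phi> y) \<and>
    \<phi> \<one>\<^bsub>V\<^esub> = \<one>\<^bsub>W\<^esub> \<and>
    (\<forall>g\<in>carrier G. \<phi> ` Vg g \<subseteq> Wg g)"

definition graded_basis ::
  "('g, 'm) monoid_scheme \<Rightarrow> ('k, 'l) ring_scheme \<Rightarrow>
   ('k, 'v, 'n) module_scheme \<Rightarrow> ('g \<Rightarrow> 'v set) \<Rightarrow> ('g \<Rightarrow> 'v) \<Rightarrow> bool"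
  where "graded_basis G K V Vg v \<longleftrightarrow>
    inj_on v (carrier G) \<and>
    vectorspace.basis K V (v ` carrier G) \<and>
    (\<forall>g\<in>carrier G. v g \<in> Vg g)"


section \<open>Cochains with values in a trivial module\<close>

text \<open>
  \<open>A\<close> is an abelian group, written multiplicatively, with trivial action of \<open>G\<close>.  Cochains are
  extensional functions, so that equality of cochains is equality on \<open>G\<^sup>n\<close>.
\<close>

definition cochains1 :: "('g, 'm) monoid_scheme \<Rightarrow> ('k, 'n) monoid_scheme \<Rightarrow> ('g \<Rightarrow> 'k) monoid"
  where "cochains1 G A = product_group (carrier G) (\<lambda>_. A)"

definition cochains2 ::
  "('g, 'm) monoid_scheme \<Rightarrow> ('k, 'n) monoid_scheme \<Rightarrow> ('g \<times> 'g \<Rightarrow> 'k) monoid"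
  where "cochains2 G A = product_group (carrier G \<times> carrier G) (\<lambda>_. A)"

definition cochains3 ::
  "('g, 'm) monoid_scheme \<Rightarrow> ('k, 'n) monoid_scheme \<Rightarrow> ('g \<times> 'g \<times> 'g \<Rightarrow> 'k) monoid"
  where "cochains3 G A = product_group (carrier G \<times> carrier G \<times> carrier G) (\<lambda>_. A)"

definition d1 ::
  "('g, 'm) monoid_scheme \<Rightarrow> ('k, 'n) monoid_scheme \<Rightarrow> ('g \<Rightarrow> 'k) \<Rightarrow> ('g \<times> 'g \<Rightarrow> 'k)"
  where "d1 G A \<phi> = (\<lambda>(a, b)\<in>carrier G \<times> carrier G.
    \<phi> b \<otimes>\<^bsub>A\<^esub> inv\<^bsub>A\<^esub> (\<phi> (a \<otimes>\<^bsub>G\<^esub> b)) \<otimes>\<^bsub>A\<^esub> \<phi> a)"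

definition d2 ::
  "('g, 'm) monoid_scheme \<Rightarrow> ('k, 'n) monoid_scheme \<Rightarrow> ('g \<times> 'g \<Rightarrow> 'k) \<Rightarrow> ('g \<times> 'g \<times> 'g \<Rightarrow> 'k)"
  where "d2 G A C = (\<lambda>(a, b, c)\<in>carrier G \<times> carrier G \<times> carrier G.
    C (b, c) \<otimes>\<^bsub>A\<^esub> inv\<^bsub>A\<^esub> (C (a \<otimes>\<^bsub>G\<^esub> b, c)) \<otimes>\<^bsub>A\<^esub> C (a, b \<otimes>\<^bsub>G\<^esub> c) \<otimes>\<^bsub>A\<^esub> inv\<^bsub>A\<^esub> (C (a, b)))"

definition cocycles2 ::
  "('g, 'm) monoid_scheme \<Rightarrow> ('k, 'n) monoid_scheme \<Rightarrow> ('g \<times> 'g \<Rightarrow> 'k) set"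
  where "cocycles2 G A = kernel (cochains2 G A) (cochains3 G A) (d2 G A)"

definition coboundaries2 ::
  "('g, 'm) monoid_scheme \<Rightarrow> ('k, 'n) monoid_scheme \<Rightarrow> ('g \<times> 'g \<Rightarrow> 'k) set"
  where "coboundaries2 G A = d1 G A ` carrier (cochains1 G A)"

definition H2 ::
  "('g, 'm) monoid_scheme \<Rightarrow> ('k, 'n) monoid_scheme \<Rightarrow> ('g \<times> 'g \<Rightarrow> 'k) set monoid"
  where "H2 G A = (cochains2 G A)\<lparr>carrier := cocycles2 G A\<rparr> Mod coboundaries2 G A"

definition H2_class ::
  "('g, 'm) monoid_scheme \<Rightarrow> ('k, 'n) monoid_scheme \<Rightarrow> ('g \<times> 'g \<Rightarrow> 'k) \<Rightarrow> ('g \<times> 'g \<Rightarrow> 'k) set"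
  where "H2_class G A C = coboundaries2 G A #>\<^bsub>(cochains2 G A)\<lparr>carrier := cocycles2 G A\<rparr>\<^esub> C"

text \<open>
  Every graded basis \<open>v\<close> has exactly one structure constant (\<open>ex1_structure_constant\<close> below).
  The normalisation \<open>v \<one> = \<one>\<close> is not imposed; normalised bases are a special case.
\<close>

definition structure_constant ::
  "('g, 'm) monoid_scheme \<Rightarrow> ('k, 'l) ring_scheme \<Rightarrow>
   ('k, 'v, 'n) module_scheme \<Rightarrow> ('g \<Rightarrow> 'v) \<Rightarrow> ('g \<times> 'g \<Rightarrow> 'k) \<Rightarrow> bool"
  where "structure_constant G K V v C \<longleftrightarrow>
    C \<in> carrier (cochains2 G (units_of K)) \<and>
    (\<forall>a\<in>carrier G. \<forall>b\<in>carrier G. v a \<otimes>\<^bsub>V\<^esub> v b = C (a, b) \<odot>\<^bsub>V\<^esub> v (a \<otimes>\<^bsub>G\<^esub> b))"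


section \<open>Well-definedness\<close>

context graded_twisted_algebra
begin

lemma component_in_carrier: "g \<in> carrier G \<Longrightarrow> x \<in> Vg g \<Longrightarrow> x \<in> carrier V"
  using component_subspace[of g] submodule.subset[of K "Vg g" V]
  by (auto simp: subspace_def)

lemma component_gen:
  assumes g: "g \<in> carrier G"
  obtains u where "u \<in> Vg g" "\<And>x. x \<in> Vg g \<Longrightarrow> \<exists>c\<in>carrier K. x = c \<odot>\<^bsub>V\<^esub> u"
proof -
  interpret L: vectorspace K "vs (Vg g)"
    using subspace_is_vs[OF component_subspace[OF g]] .
  let ?P = "\<lambda>n. \<exists>A. finite A \<and> card A = n \<and> A \<subseteq> carrier (vs (Vg g)) \<and> L.gen_set A"
  have "L.fin_dim" "L.dim = 1" using one_dimensional[OF g] by auto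
  then have "?P (LEAST n. ?P n)" "(LEAST n. ?P n) = 1"
    unfolding L.fin_dim_def L.dim_def by - (rule LeastI_ex, auto)
  then have "?P 1" by simp
  then obtain A where A: "card A = 1" "A \<subseteq> Vg g" "L.gen_set A" by auto
  from A(1) obtain u where u: "A = {u}" by (rule card_1_singletonE)
  have uV: "u \<in> Vg g" using A(2) u by auto
  have "\<exists>c\<in>carrier K. x = c \<odot>\<^bsub>V\<^esub> u" if "x \<in> Vg g" for x
  proof -
    have "x \<in> L.span {u}" using A(3) u that by simp
    then obtain a where a: "a \<in> {u} \<rightarrow> carrier K" "x = L.lincomb a {u}"
      using L.finite_span[of "{u}"] uV by auto
    have "L.lincomb a {u} = a u \<odot>\<^bsub>V\<^esub> u"
      unfolding L.lincomb_def
      using L.M.finsum_insert[of "{}" u "\<lambda>v. a v \<odot>\<^bsub>V\<^esub> v"] a uV L.smult_closed[of "a u" u]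
        L.M.r_zero[of "a u \<odot>\<^bsub>V\<^esub> u"]
      by auto
    then show ?thesis using a by auto
  qed
  with uV show thesis by (rule that)
qed

lemma smult_eq_zeroD:
  assumes "c \<in> carrier K" "x \<in> carrier V" "c \<odot>\<^bsub>V\<^esub> x = \<zero>\<^bsub>V\<^esub>" "x \<noteq> \<zero>\<^bsub>V\<^esub>"
  shows "c = \<zero>\<^bsub>K\<^esub>"
proof (rule ccontr)
  assume "c \<noteq> \<zero>\<^bsub>K\<^esub>"
  then have c: "c \<in> Units K" using assms field_Units by auto
  have "x = (inv\<^bsub>K\<^esub> c \<otimes>\<^bsub>K\<^esub> c) \<odot>\<^bsub>V\<^esub> x" using c assms by simp
  also have "\<dots> = inv\<^bsub>K\<^esub> c \<odot>\<^bsub>V\<^esub> (c \<odot>\<^bsub>V\<^esub> x)" using c assms by (intro smult_assoc1) auto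
  also have "\<dots> = \<zero>\<^bsub>V\<^esub>" using assms c by simp
  finally show False using assms by simp
qed

lemma ex1_structure_constant:
  assumes v: "graded_basis G K V Vg v"
  shows "\<exists>!C. structure_constant G K V v C"
proof -
  have vV: "v g \<in> Vg g" if "g \<in> carrier G" for g using v that by (auto simp: graded_basis_def)
  have vc: "v g \<in> carrier V" if "g \<in> carrier G" for g
    using vV component_in_carrier that by blast
  have v0: "v g \<noteq> \<zero>\<^bsub>V\<^esub>" if "g \<in> carrier G" for g
    using v vs_zero_lin_dep[of "v ` carrier G"] imageI[OF that, of v]
    unfolding graded_basis_def basis_def by metis
  have gen: "\<exists>c\<in>Units K. x = c \<odot>\<^bsub>V\<^esub> v g"
    if g: "g \<in> carrier G" and x: "x \<in> Vg g" "x \<noteq> \<zero>\<^bsub>V\<^esub>" for g x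
  proof -
    obtain u where u: "u \<in> Vg g" "\<And>x. x \<in> Vg g \<Longrightarrow> \<exists>c\<in>carrier K. x = c \<odot>\<^bsub>V\<^esub> u"
      using component_gen[OF g] by blast
    have uc: "u \<in> carrier V" using component_in_carrier g u by blast
    obtain c where c: "c \<in> carrier K" "x = c \<odot>\<^bsub>V\<^esub> u" using u x by blast
    obtain d where d: "d \<in> carrier K" "v g = d \<odot>\<^bsub>V\<^esub> u" using u vV g by blast
    have "c \<noteq> \<zero>\<^bsub>K\<^esub>" "d \<noteq> \<zero>\<^bsub>K\<^esub>" using x c v0[OF g] d uc by auto
    then have cd: "c \<in> Units K" "d \<in> Units K" using c d field_Units by auto
    have "(c \<otimes>\<^bsub>K\<^esub> inv\<^bsub>K\<^esub> d) \<odot>\<^bsub>V\<^esub> v g = (c \<otimes>\<^bsub>K\<^esub> inv\<^bsub>K\<^esub> d \<otimes>\<^bsub>K\<^esub> d) \<odot>\<^bsub>V\<^esub> u"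
      using cd c d uc by (simp add: smult_assoc1)
    also have "\<dots> = x" using cd c d by (simp add: R.m_assoc R.Units_l_inv)
    finally show ?thesis using cd by (intro bexI[of _ "c \<otimes>\<^bsub>K\<^esub> inv\<^bsub>K\<^esub> d"]) auto
  qed
  have "\<exists>c\<in>Units K. v a \<otimes>\<^bsub>V\<^esub> v b = c \<odot>\<^bsub>V\<^esub> v (a \<otimes>\<^bsub>G\<^esub> b)"
    if "a \<in> carrier G" "b \<in> carrier G" for a b
    using that graded_mult mult_nonzero vV v0 by (intro gen) auto
  then obtain c where c: "\<And>a b. a \<in> carrier G \<Longrightarrow> b \<in> carrier G \<Longrightarrow>
      c a b \<in> Units K \<and> v a \<otimes>\<^bsub>V\<^esub> v b = c a b \<odot>\<^bsub>V\<^esub> v (a \<otimes>\<^bsub>G\<^esub> b)"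
    by metis
  have uniq: "c = d"
    if cd: "c \<in> carrier K" "d \<in> carrier K" "c \<odot>\<^bsub>V\<^esub> v g = d \<odot>\<^bsub>V\<^esub> v g" and g: "g \<in> carrier G" for c d g
  proof -
    have "(c \<ominus>\<^bsub>K\<^esub> d) \<odot>\<^bsub>V\<^esub> v g = \<zero>\<^bsub>V\<^esub>"
      using cd vc[OF g]
      by (simp add: R.minus_eq smult_l_distr smult_l_minus M.r_neg)
    then have "c \<ominus>\<^bsub>K\<^esub> d = \<zero>\<^bsub>K\<^esub>"
      using smult_eq_zeroD[of "c \<ominus>\<^bsub>K\<^esub> d", OF _ vc[OF g] _ v0[OF g]] cd(1,2) R.minus_closed by blast
    then have "\<ominus>\<^bsub>K\<^esub> (\<ominus>\<^bsub>K\<^esub> d) = c"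
      using cd(1,2) by (intro R.minus_equality) (simp_all add: R.minus_eq)
    then show ?thesis using cd(2) by simp
  qed
  show ?thesis
  proof
    show "structure_constant G K V v (\<lambda>(a, b)\<in>carrier G \<times> carrier G. c a b)"
      using c by (auto simp: structure_constant_def cochains2_def units_of_carrier)
  next
    fix C assume C: "structure_constant G K V v C"
    show "C = (\<lambda>(a, b)\<in>carrier G \<times> carrier G. c a b)"
    proof (rule extensionalityI[of _ "carrier G \<times> carrier G"])
      show "C \<in> extensional (carrier G \<times> carrier G)"
        using C by (auto simp: structure_constant_def cochains2_def PiE_def)
      fix p assume "p \<in> carrier G \<times> carrier G"
      then obtain a b where p: "p = (a, b)" "a \<in> carrier G" "b \<in> carrier G" by auto
      then have "C (a, b) \<in> Units K"
        using C by (auto simp: structure_constant_def cochains2_def units_of_carrier PiE_def Pi_def)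
      then have "C (a, b) = c a b"
        using C c[of a b] p by (intro uniq[of _ _ "a \<otimes>\<^bsub>G\<^esub> b"]) (auto simp: structure_constant_def)
      then show "C p = (\<lambda>(a, b)\<in>carrier G \<times> carrier G. c a b) p" using p by simp
    qed auto
  qed
qed

end

lemma comm_group_product_const:
  assumes "comm_group A" shows "comm_group (product_group I (\<lambda>_. A))"
proof -
  interpret A: comm_group A by fact
  show ?thesis
    by (rule group.group_comm_groupI)
       (auto simp: A.is_group PiE_def Pi_def A.m_comm fun_eq_iff restrict_def)
qed

lemma comm_group_H2:
  assumes "group G" "comm_group A"
  shows "comm_group (H2 G A)"
proof -
  interpret G: group G by fact
  interpret A: comm_group A by fact
  interpret C1: comm_group "cochains1 G A"
    unfolding cochains1_def by (rule comm_group_product_const) fact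
  interpret C2: comm_group "cochains2 G A"
    unfolding cochains2_def by (rule comm_group_product_const) fact
  interpret C3: comm_group "cochains3 G A"
    unfolding cochains3_def by (rule comm_group_product_const) fact
  interpret d1: group_hom "cochains1 G A" "cochains2 G A" "d1 G A"
  proof
    show "d1 G A \<in> hom (cochains1 G A) (cochains2 G A)"
      unfolding hom_def cochains1_def cochains2_def d1_def
      by (auto simp: PiE_def Pi_def fun_eq_iff restrict_def extensional_def A.inv_mult A.m_ac)
  qed
  interpret d2: group_hom "cochains2 G A" "cochains3 G A" "d2 G A"
  proof
    show "d2 G A \<in> hom (cochains2 G A) (cochains3 G A)"
      unfolding hom_def cochains2_def cochains3_def d2_def
      by (auto simp: PiE_def Pi_def fun_eq_iff restrict_def extensional_def A.inv_mult A.m_ac)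
  qed
  have Z: "subgroup (cocycles2 G A) (cochains2 G A)"
    unfolding cocycles2_def by (rule d2.subgroup_kernel)
  have B: "subgroup (coboundaries2 G A) (cochains2 G A)"
    unfolding coboundaries2_def by (rule d1.img_is_subgroup)
  have "coboundaries2 G A \<subseteq> cocycles2 G A"
  proof
    fix C assume "C \<in> coboundaries2 G A"
    then obtain \<phi> where \<phi>: "\<phi> \<in> carrier (cochains1 G A)" "C = d1 G A \<phi>"
      by (auto simp: coboundaries2_def)
    have Ac: "\<phi> g \<in> carrier A" if "g \<in> carrier G" for g
      using \<phi> that by (auto simp: cochains1_def)
    have "d2 G A C = \<one>\<^bsub>cochains3 G A\<^esub>"
    proof (rule extensionalityI[of _ "carrier G \<times> carrier G \<times> carrier G"])
      fix p assume "p \<in> carrier G \<times> carrier G \<times> carrier G"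
      then obtain a b c where p: "p = (a, b, c)" "a \<in> carrier G" "b \<in> carrier G" "c \<in> carrier G"
        by auto
      let ?a = "\<phi> a" and ?b = "\<phi> b" and ?c = "\<phi> c" and ?ab = "\<phi> (a \<otimes>\<^bsub>G\<^esub> b)"
        and ?bc = "\<phi> (b \<otimes>\<^bsub>G\<^esub> c)" and ?abc = "\<phi> (a \<otimes>\<^bsub>G\<^esub> (b \<otimes>\<^bsub>G\<^esub> c))"
      have "d2 G A C p = (?c \<otimes>\<^bsub>A\<^esub> inv\<^bsub>A\<^esub> ?bc \<otimes>\<^bsub>A\<^esub> ?b) \<otimes>\<^bsub>A\<^esub> inv\<^bsub>A\<^esub> (?c \<otimes>\<^bsub>A\<^esub> inv\<^bsub>A\<^esub> ?abc \<otimes>\<^bsub>A\<^esub> ?ab)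
          \<otimes>\<^bsub>A\<^esub> (?bc \<otimes>\<^bsub>A\<^esub> inv\<^bsub>A\<^esub> ?abc \<otimes>\<^bsub>A\<^esub> ?a) \<otimes>\<^bsub>A\<^esub> inv\<^bsub>A\<^esub> (?b \<otimes>\<^bsub>A\<^esub> inv\<^bsub>A\<^esub> ?ab \<otimes>\<^bsub>A\<^esub> ?a)"
        using p by (simp add: d2_def \<phi>(2) d1_def G.m_assoc)
      also have "\<dots> = \<one>\<^bsub>A\<^esub>"
      proof -
        have "inv\<^bsub>A\<^esub> ?a \<otimes>\<^bsub>A\<^esub> (inv\<^bsub>A\<^esub> ?b \<otimes>\<^bsub>A\<^esub> inv\<^bsub>A\<^esub> ?c) = inv\<^bsub>A\<^esub> (?a \<otimes>\<^bsub>A\<^esub> (?b \<otimes>\<^bsub>A\<^esub> ?c))"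
          using p Ac by (simp add: A.inv_mult)
        then have "?a \<otimes>\<^bsub>A\<^esub> (?b \<otimes>\<^bsub>A\<^esub> (?c \<otimes>\<^bsub>A\<^esub> (inv\<^bsub>A\<^esub> ?a \<otimes>\<^bsub>A\<^esub> (inv\<^bsub>A\<^esub> ?b \<otimes>\<^bsub>A\<^esub> inv\<^bsub>A\<^esub> ?c)))) = \<one>\<^bsub>A\<^esub>"
          using p Ac A.r_inv[of "?a \<otimes>\<^bsub>A\<^esub> (?b \<otimes>\<^bsub>A\<^esub> ?c)"] by (metis A.m_assoc A.m_closed A.inv_closed)
        then show ?thesis using p Ac by (simp add: A.inv_mult A.m_ac)
      qed
      finally show "d2 G A C p = \<one>\<^bsub>cochains3 G A\<^esub> p" using p by (simp add: cochains3_def)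
    qed (auto simp: d2_def cochains3_def)
    then show "C \<in> cocycles2 G A"
      using \<phi> by (auto simp: cocycles2_def kernel_def)
  qed
  then have "subgroup (coboundaries2 G A) ((cochains2 G A)\<lparr>carrier := cocycles2 G A\<rparr>)"
    using C2.subgroup_incl B Z by blast
  moreover have "comm_group ((cochains2 G A)\<lparr>carrier := cocycles2 G A\<rparr>)"
    by (rule group.group_comm_groupI[OF C2.subgroup_imp_group[OF Z]])
       (use subgroup.mem_carrier[OF Z] C2.m_comm in auto)
  ultimately show ?thesis
    unfolding H2_def by (rule comm_group.abelian_FactGroup[rotated])
qed

end

theory Submission
  imports Defs
begin

text \<open>
  A graded isomorphism sends \<open>v g\<close> to \<open>c g \<odot> w g\<close> with a nonzero scalar \<open>c g\<close>, and comparing the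
  images of \<open>v a \<otimes> v b\<close> says exactly that \<open>C1 / C2\<close> is the coboundary of \<open>c\<close>.  Conversely, if
  \<open>C1 / C2\<close> is the coboundary of \<open>c\<close>, then the vectors \<open>c g \<odot> w g\<close> have the same structure constant
  as the vectors \<open>v g\<close>, so identifying coordinates is a multiplicative linear bijection; it
  preserves the identity because it is onto.
\<close>

section \<open>Cohomology classes of two-cochains\<close>

lemma d1_mem_cochains2:
  assumes "group G" "comm_group A" "\<phi> \<in> carrier (cochains1 G A)"
  shows "d1 G A \<phi> \<in> carrier (cochains2 G A)"
proof -
  interpret G: group G by fact
  interpret A: comm_group A by fact
  show ?thesis
    using assms(3) by (auto simp: cochains1_def cochains2_def d1_def PiE_iff)
qed

text \<open>Since \<open>A\<close> is commutative, \<open>d1\<close> is a homomorphism, and the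
  image of a homomorphism is a subgroup. This is what makes membership in cosets of coboundaries
  computable below.\<close>

lemma subgroup_coboundaries2:
  assumes "group G" "comm_group A"
  shows "subgroup (coboundaries2 G A) (cochains2 G A)"
proof -
  interpret G: group G by fact
  interpret A: comm_group A by fact
  interpret d1: group_hom "cochains1 G A" "cochains2 G A" "d1 G A"
  proof (intro group_hom.intro group_hom_axioms.intro homI)
    show "group (cochains1 G A)" "group (cochains2 G A)"
      by (simp_all add: cochains1_def cochains2_def)
    show "d1 G A \<phi> \<in> carrier (cochains2 G A)" if "\<phi> \<in> carrier (cochains1 G A)" for \<phi>
      using d1_mem_cochains2 assms that by blast
    show "d1 G A (\<phi> \<otimes>\<^bsub>cochains1 G A\<^esub> \<psi>) = d1 G A \<phi> \<otimes>\<^bsub>cochains2 G A\<^esub> d1 G A \<psi>"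
      if "\<phi> \<in> carrier (cochains1 G A)" "\<psi> \<in> carrier (cochains1 G A)" for \<phi> \<psi>
      using that
      by (auto simp: cochains1_def cochains2_def d1_def PiE_iff fun_eq_iff A.inv_mult A.m_ac)
  qed
  show ?thesis
    unfolding coboundaries2_def by (rule d1.img_is_subgroup)
qed

text \<open>By associativity of \<open>G\<close>, only six values of \<open>\<phi>\<close> occur: at
  \<open>a\<close>, \<open>b\<close>, \<open>c\<close>, \<open>ab\<close>, \<open>bc\<close> and
  \<open>abc\<close>. Each occurs once plain and once inverted, so they cancel in the commutative
  group \<open>A\<close>. The fact \<open>cancel\<close> states this for six arbitrary
  elements.\<close>

lemma d2_d1:
  assumes "group G" "comm_group A" and \<phi>: "\<phi> \<in> carrier (cochains1 G A)"
  shows "d2 G A (d1 G A \<phi>) = \<one>\<^bsub>cochains3 G A\<^esub>"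
proof -
  interpret G: group G by fact
  interpret A: comm_group A by fact
  have cancel: "(z \<otimes>\<^bsub>A\<^esub> inv\<^bsub>A\<^esub> q \<otimes>\<^bsub>A\<^esub> y) \<otimes>\<^bsub>A\<^esub> inv\<^bsub>A\<^esub> (z \<otimes>\<^bsub>A\<^esub> inv\<^bsub>A\<^esub> r \<otimes>\<^bsub>A\<^esub> p)
      \<otimes>\<^bsub>A\<^esub> (q \<otimes>\<^bsub>A\<^esub> inv\<^bsub>A\<^esub> r \<otimes>\<^bsub>A\<^esub> x) \<otimes>\<^bsub>A\<^esub> inv\<^bsub>A\<^esub> (y \<otimes>\<^bsub>A\<^esub> inv\<^bsub>A\<^esub> p \<otimes>\<^bsub>A\<^esub> x) = \<one>\<^bsub>A\<^esub>"
    if "x \<in> carrier A" "y \<in> carrier A" "z \<in> carrier A" "p \<in> carrier A" "q \<in> carrier A"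
      "r \<in> carrier A" for x y z p q r
  proof -
    have *: "u \<otimes>\<^bsub>A\<^esub> (inv\<^bsub>A\<^esub> u \<otimes>\<^bsub>A\<^esub> s) = s" if "u \<in> carrier A" "s \<in> carrier A" for u s
      using that by (simp add: A.m_assoc[symmetric])
    \<comment> \<open>Both sides have the same normal form up to commutativity. The right side is
      nested so that \<open>*\<close> strips one pair of mutually inverse factors after
      another.\<close>
    have "(z \<otimes>\<^bsub>A\<^esub> inv\<^bsub>A\<^esub> q \<otimes>\<^bsub>A\<^esub> y) \<otimes>\<^bsub>A\<^esub> inv\<^bsub>A\<^esub> (z \<otimes>\<^bsub>A\<^esub> inv\<^bsub>A\<^esub> r \<otimes>\<^bsub>A\<^esub> p)
        \<otimes>\<^bsub>A\<^esub> (q \<otimes>\<^bsub>A\<^esub> inv\<^bsub>A\<^esub> r \<otimes>\<^bsub>A\<^esub> x) \<otimes>\<^bsub>A\<^esub> inv\<^bsub>A\<^esub> (y \<otimes>\<^bsub>A\<^esub> inv\<^bsub>A\<^esub> p \<otimes>\<^bsub>A\<^esub> x)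
      = x \<otimes>\<^bsub>A\<^esub> (inv\<^bsub>A\<^esub> x \<otimes>\<^bsub>A\<^esub> (y \<otimes>\<^bsub>A\<^esub> (inv\<^bsub>A\<^esub> y \<otimes>\<^bsub>A\<^esub> (z \<otimes>\<^bsub>A\<^esub> (inv\<^bsub>A\<^esub> z \<otimes>\<^bsub>A\<^esub>
          (p \<otimes>\<^bsub>A\<^esub> (inv\<^bsub>A\<^esub> p \<otimes>\<^bsub>A\<^esub> (q \<otimes>\<^bsub>A\<^esub> (inv\<^bsub>A\<^esub> q \<otimes>\<^bsub>A\<^esub> (r \<otimes>\<^bsub>A\<^esub> inv\<^bsub>A\<^esub> r))))))))))"
      using that by (simp only: A.inv_mult A.inv_inv A.m_closed A.inv_closed A.m_ac)
    then show ?thesis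
      using that by (simp add: *)
  qed
  show ?thesis
  proof (rule extensionalityI[of _ "carrier G \<times> carrier G \<times> carrier G"])
    fix t assume "t \<in> carrier G \<times> carrier G \<times> carrier G"
    then show "d2 G A (d1 G A \<phi>) t = \<one>\<^bsub>cochains3 G A\<^esub> t"
      using \<phi> by (auto simp: d2_def d1_def cochains1_def cochains3_def G.m_assoc cancel PiE_iff)
  qed (auto simp: d2_def cochains3_def)
qed

text \<open>The identity of the quotient is the subgroup of coboundaries itself, and a coset of a
  subgroup equals the subgroup exactly when its representative lies in it. In the backward direction
  \<open>d2_d1\<close> supplies the cocycle condition.\<close>

lemma trivial_class_iff_coboundary:
  assumes "group G" "comm_group A"
  shows "D \<in> kernel (cochains2 G A) (cochains3 G A) (d2 G A) \<and> H2_class G A D = \<one>\<^bsub>H2 G A\<^esub>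
    \<longleftrightarrow> D \<in> coboundaries2 G A" (is "?L \<longleftrightarrow> ?R")
proof -
  interpret A: comm_group A by fact
  interpret C2: group "cochains2 G A"
    by (simp add: cochains2_def)
  interpret B: subgroup "coboundaries2 G A" "cochains2 G A"
    by (rule subgroup_coboundaries2) fact+
  \<comment> \<open>A coset depends on the multiplication only, so it can be computed in the full
    cochain group, where the coset lemmas apply.\<close>
  have cls: "H2_class G A D = coboundaries2 G A #>\<^bsub>cochains2 G A\<^esub> D"
    by (simp add: H2_class_def r_coset_def)
  have one: "\<one>\<^bsub>H2 G A\<^esub> = coboundaries2 G A"
    by (simp add: H2_def FactGroup_def)
  show ?thesis
  proof
    assume L: ?L
    then have D: "D \<in> carrier (cochains2 G A)"
      by (simp add: kernel_def)
    show ?R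
      using C2.rcos_self[OF D B.subgroup_axioms] L cls one by simp
  next
    assume R: ?R
    then have "H2_class G A D = \<one>\<^bsub>H2 G A\<^esub>"
      unfolding cls one using C2.coset_join2 B.subgroup_axioms B.mem_carrier by blast
    moreover from R obtain \<phi> where "\<phi> \<in> carrier (cochains1 G A)" "D = d1 G A \<phi>"
      by (auto simp: coboundaries2_def)
    ultimately show ?L
      using d2_d1[OF assms] d1_mem_cochains2[OF assms] by (simp add: kernel_def)
  qed
qed

text \<open>Clearing denominators turns the coboundary condition into an equation free of inverses,
  which can later be read as an equality of scalars in front of one vector.\<close>

lemma quotient_in_coboundaries2_iff:
  assumes "group G" "comm_group A"
    and "C1 \<in> carrier (cochains2 G A)" "C2 \<in> carrier (cochains2 G A)"
  shows "C1 \<otimes>\<^bsub>cochains2 G A\<^esub> inv\<^bsub>cochains2 G A\<^esub> C2 \<in> coboundaries2 G A \<longleftrightarrow>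
    (\<exists>c \<in> carrier G \<rightarrow> carrier A. \<forall>a\<in>carrier G. \<forall>b\<in>carrier G.
      C1 (a, b) \<otimes>\<^bsub>A\<^esub> c (a \<otimes>\<^bsub>G\<^esub> b) = c a \<otimes>\<^bsub>A\<^esub> c b \<otimes>\<^bsub>A\<^esub> C2 (a, b))"
proof -
  interpret G: group G by fact
  interpret A: comm_group A by fact
  let ?D = "C1 \<otimes>\<^bsub>cochains2 G A\<^esub> inv\<^bsub>cochains2 G A\<^esub> C2"
  have D: "?D = (\<lambda>(a, b)\<in>carrier G \<times> carrier G. C1 (a, b) \<otimes>\<^bsub>A\<^esub> inv\<^bsub>A\<^esub> C2 (a, b))"
    using assms(4) by (auto simp: cochains2_def fun_eq_iff)
  have arith: "x \<otimes>\<^bsub>A\<^esub> inv\<^bsub>A\<^esub> y = r \<otimes>\<^bsub>A\<^esub> inv\<^bsub>A\<^esub> p \<otimes>\<^bsub>A\<^esub> q \<longleftrightarrow> x \<otimes>\<^bsub>A\<^esub> p = q \<otimes>\<^bsub>A\<^esub> r \<otimes>\<^bsub>A\<^esub> y"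
    if "x \<in> carrier A" "y \<in> carrier A" "p \<in> carrier A" "q \<in> carrier A" "r \<in> carrier A"
    for x y p q r
  proof -
    \<comment> \<open>Multiplying by \<open>p\<close> and \<open>y\<close> clears both inverses;
      cancellation makes this an equivalence.\<close>
    have "x \<otimes>\<^bsub>A\<^esub> inv\<^bsub>A\<^esub> y = r \<otimes>\<^bsub>A\<^esub> inv\<^bsub>A\<^esub> p \<otimes>\<^bsub>A\<^esub> q \<longleftrightarrow>
        (x \<otimes>\<^bsub>A\<^esub> inv\<^bsub>A\<^esub> y) \<otimes>\<^bsub>A\<^esub> (p \<otimes>\<^bsub>A\<^esub> y) = (r \<otimes>\<^bsub>A\<^esub> inv\<^bsub>A\<^esub> p \<otimes>\<^bsub>A\<^esub> q) \<otimes>\<^bsub>A\<^esub> (p \<otimes>\<^bsub>A\<^esub> y)"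
      using that by (intro A.right_cancel[symmetric]) auto
    also have "(x \<otimes>\<^bsub>A\<^esub> inv\<^bsub>A\<^esub> y) \<otimes>\<^bsub>A\<^esub> (p \<otimes>\<^bsub>A\<^esub> y) = x \<otimes>\<^bsub>A\<^esub> p \<otimes>\<^bsub>A\<^esub> (y \<otimes>\<^bsub>A\<^esub> inv\<^bsub>A\<^esub> y)"
      using that by (simp only: A.m_ac A.m_closed A.inv_closed)
    also have "(r \<otimes>\<^bsub>A\<^esub> inv\<^bsub>A\<^esub> p \<otimes>\<^bsub>A\<^esub> q) \<otimes>\<^bsub>A\<^esub> (p \<otimes>\<^bsub>A\<^esub> y) = q \<otimes>\<^bsub>A\<^esub> r \<otimes>\<^bsub>A\<^esub> y \<otimes>\<^bsub>A\<^esub> (p \<otimes>\<^bsub>A\<^esub> inv\<^bsub>A\<^esub> p)"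
      using that by (simp only: A.m_ac A.m_closed A.inv_closed)
    finally show ?thesis
      using that by simp
  qed
  have eq: "?D = d1 G A c \<longleftrightarrow> (\<forall>a\<in>carrier G. \<forall>b\<in>carrier G.
      C1 (a, b) \<otimes>\<^bsub>A\<^esub> c (a \<otimes>\<^bsub>G\<^esub> b) = c a \<otimes>\<^bsub>A\<^esub> c b \<otimes>\<^bsub>A\<^esub> C2 (a, b))"
    if c: "c \<in> carrier G \<rightarrow> carrier A" for c
  proof -
    have "?D = d1 G A c \<longleftrightarrow> (\<forall>a\<in>carrier G. \<forall>b\<in>carrier G.
        C1 (a, b) \<otimes>\<^bsub>A\<^esub> inv\<^bsub>A\<^esub> C2 (a, b) = c b \<otimes>\<^bsub>A\<^esub> inv\<^bsub>A\<^esub> c (a \<otimes>\<^bsub>G\<^esub> b) \<otimes>\<^bsub>A\<^esub> c a)"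
      unfolding D d1_def by (auto simp: fun_eq_iff restrict_def)
    also have "\<dots> \<longleftrightarrow> (\<forall>a\<in>carrier G. \<forall>b\<in>carrier G.
        C1 (a, b) \<otimes>\<^bsub>A\<^esub> c (a \<otimes>\<^bsub>G\<^esub> b) = c a \<otimes>\<^bsub>A\<^esub> c b \<otimes>\<^bsub>A\<^esub> C2 (a, b))"
      using assms(3,4) c
      by (intro ball_cong refl arith) (auto simp: cochains2_def PiE_iff Pi_iff)
    finally show ?thesis .
  qed
  \<comment> \<open>\<open>d1\<close> evaluates its argument on \<open>G\<close> only, so
    restricting \<open>c\<close> to \<open>G\<close> leaves its coboundary unchanged. The
    extensionality required of cochains thus disappears from the condition on
    \<open>c\<close>.\<close>
  have "coboundaries2 G A = d1 G A ` (carrier G \<rightarrow> carrier A)"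
  proof (intro equalityI subsetI)
    fix C assume "C \<in> d1 G A ` (carrier G \<rightarrow> carrier A)"
    then obtain c where c: "c \<in> carrier G \<rightarrow> carrier A" "C = d1 G A c" by blast
    then have "C = d1 G A (restrict c (carrier G))"
      by (auto simp: d1_def fun_eq_iff)
    moreover have "restrict c (carrier G) \<in> carrier (cochains1 G A)"
      using c by (auto simp: cochains1_def)
    ultimately show "C \<in> coboundaries2 G A"
      unfolding coboundaries2_def by (rule image_eqI)
  qed (auto simp: coboundaries2_def cochains1_def PiE_def)
  then show ?thesis
    using eq by (auto simp: image_iff)
qed

section \<open>Homogeneous coordinates\<close>

context graded_twisted_algebra
begin

section \<open>Scalar multiples inside one homogeneous component\<close>

lemma component_smult_closed:
  "g \<in> carrier G \<Longrightarrow> c \<in> carrier K \<Longrightarrow> x \<in> Vg g \<Longrightarrow> c \<odot>\<^bsub>V\<^esub> x \<in> Vg g"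
  using component_subspace[of g] submodule.smult_closed[of K "Vg g" V]
  by (simp add: subspace_def)

text \<open>\<open>component_gen\<close> yields some generator \<open>e\<close> of the line. The
  nonzero vector \<open>u\<close> is a unit multiple of \<open>e\<close>, so dividing by that unit
  makes \<open>u\<close> a generator as well.\<close>

lemma component_multiple:
  assumes g: "g \<in> carrier G" and u: "u \<in> Vg g" "u \<noteq> \<zero>\<^bsub>V\<^esub>" and x: "x \<in> Vg g"
  shows "\<exists>c\<in>carrier K. x = c \<odot>\<^bsub>V\<^esub> u"
proof -
  obtain e where e: "e \<in> Vg g" "\<And>x. x \<in> Vg g \<Longrightarrow> \<exists>c\<in>carrier K. x = c \<odot>\<^bsub>V\<^esub> e"
    using component_gen[OF g] by blast
  have eV: "e \<in> carrier V" using component_in_carrier g e by blast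
  obtain c where c: "c \<in> carrier K" "x = c \<odot>\<^bsub>V\<^esub> e" using e x by blast
  obtain d where d: "d \<in> carrier K" "u = d \<odot>\<^bsub>V\<^esub> e" using e u by blast
  have "d \<noteq> \<zero>\<^bsub>K\<^esub>" using u d eV by auto
  then have dU: "d \<in> Units K" using d field_Units by auto
  have "(c \<otimes>\<^bsub>K\<^esub> inv\<^bsub>K\<^esub> d) \<odot>\<^bsub>V\<^esub> u = (c \<otimes>\<^bsub>K\<^esub> inv\<^bsub>K\<^esub> d \<otimes>\<^bsub>K\<^esub> d) \<odot>\<^bsub>V\<^esub> e"
    using dU c d eV by (simp add: smult_assoc1)
  also have "\<dots> = x" using dU c d by (simp add: R.m_assoc R.Units_l_inv)
  finally show ?thesis using dU c by (intro bexI[of _ "c \<otimes>\<^bsub>K\<^esub> inv\<^bsub>K\<^esub> d"]) auto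
qed

lemma smult_right_cancel:
  assumes "c \<in> carrier K" "d \<in> carrier K" "x \<in> carrier V" "x \<noteq> \<zero>\<^bsub>V\<^esub>"
    "c \<odot>\<^bsub>V\<^esub> x = d \<odot>\<^bsub>V\<^esub> x"
  shows "c = d"
proof -
  have "(c \<ominus>\<^bsub>K\<^esub> d) \<odot>\<^bsub>V\<^esub> x = \<zero>\<^bsub>V\<^esub>"
    using assms by (simp add: R.minus_eq smult_l_distr smult_l_minus M.r_neg)
  then have "c \<ominus>\<^bsub>K\<^esub> d = \<zero>\<^bsub>K\<^esub>"
    using smult_eq_zeroD[of "c \<ominus>\<^bsub>K\<^esub> d" x] assms R.minus_closed by blast
  then show ?thesis using assms by simp
qed

text \<open>A linearly independent set cannot contain zero. Linear independence enters the later
  arguments through this fact.\<close>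

lemma graded_basis_nonzero:
  assumes "graded_basis G K V Vg v" "g \<in> carrier G"
  shows "v g \<noteq> \<zero>\<^bsub>V\<^esub>"
  using assms vs_zero_lin_dep[of "v ` carrier G"] imageI[OF assms(2), of v]
  unfolding graded_basis_def basis_def by metis

text \<open>Every vector is a finite sum of homogeneous ones. The rule serves to extend
  multiplicativity of a linear map from homogeneous vectors to all vectors.\<close>

lemma homogeneous_induct [consumes 1, case_names zero add component]:
  assumes x: "x \<in> carrier V" and zero: "P \<zero>\<^bsub>V\<^esub>"
    and add: "\<And>x y. x \<in> carrier V \<Longrightarrow> y \<in> carrier V \<Longrightarrow> P x \<Longrightarrow> P y \<Longrightarrow> P (x \<oplus>\<^bsub>V\<^esub> y)"
    and component: "\<And>g x. g \<in> carrier G \<Longrightarrow> x \<in> Vg g \<Longrightarrow> P x"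
  shows "P x"
proof -
  obtain f where f: "f \<in> (\<Pi>\<^sub>E g\<in>carrier G. Vg g)" "x = (\<Oplus>\<^bsub>V\<^esub>g\<in>carrier G. f g)"
    using direct_sum[OF x] by blast
  \<comment> \<open>Partial sums over arbitrary subsets of \<open>G\<close> are what the induction
    on finite sets needs.\<close>
  have "P (\<Oplus>\<^bsub>V\<^esub>g\<in>A. f g)" if "finite A" "A \<subseteq> carrier G" for A
    using that
  proof (induction A rule: finite_induct)
    case (insert g A)
    have fV: "f h \<in> carrier V" if "h \<in> insert g A" for h
      using that f(1) insert.prems component_in_carrier by blast
    have "P (f g \<oplus>\<^bsub>V\<^esub> (\<Oplus>\<^bsub>V\<^esub>h\<in>A. f h))"
      using fV insert component[of g "f g"] f(1) by (intro add M.finsum_closed) auto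
    then show ?case
      using insert fV by (subst M.finsum_insert) auto
  qed (simp add: zero)
  then show ?thesis
    using f(2) finite_group by simp
qed

text \<open>The direct sum determines the component in each degree, and that component is a unique
  multiple of the nonzero \<open>v g\<close>. Asking for nonzero homogeneous vectors lets the lemma
  apply directly to a rescaled family; extensional coordinate functions make the map
  injective.\<close>

lemma homogeneous_coordinates:
  assumes v: "\<And>g. g \<in> carrier G \<Longrightarrow> v g \<in> Vg g" "\<And>g. g \<in> carrier G \<Longrightarrow> v g \<noteq> \<zero>\<^bsub>V\<^esub>"
  shows "bij_betw (\<lambda>a. \<Oplus>\<^bsub>V\<^esub>g\<in>carrier G. a g \<odot>\<^bsub>V\<^esub> v g) (carrier G \<rightarrow>\<^sub>E carrier K) (carrier V)"
proof -
  have vV: "v g \<in> carrier V" if "g \<in> carrier G" for g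
    using that v component_in_carrier by blast
  have comp: "a g \<odot>\<^bsub>V\<^esub> v g \<in> Vg g" if "a \<in> carrier G \<rightarrow> carrier K" "g \<in> carrier G" for a g
    using that v by (intro component_smult_closed) auto
  let ?E = "\<lambda>a. \<Oplus>\<^bsub>V\<^esub>g\<in>carrier G. a g \<odot>\<^bsub>V\<^esub> v g"
  \<comment> \<open>Uniqueness in \<open>direct_sum\<close> concerns extensional families, so the
    summands are first restricted to \<open>G\<close>.\<close>
  have E_restrict: "?E a = (\<Oplus>\<^bsub>V\<^esub>g\<in>carrier G. (\<lambda>g\<in>carrier G. a g \<odot>\<^bsub>V\<^esub> v g) g)"
    if "a \<in> carrier G \<rightarrow> carrier K" for a
    using that vV by (intro M.finsum_cong') (auto simp: Pi_iff)
  show ?thesis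
  proof (rule bij_betw_imageI)
    show "inj_on ?E (carrier G \<rightarrow>\<^sub>E carrier K)"
    proof (rule inj_onI)
      fix a b assume ab: "a \<in> carrier G \<rightarrow>\<^sub>E carrier K" "b \<in> carrier G \<rightarrow>\<^sub>E carrier K" "?E a = ?E b"
      then have Pi: "a \<in> carrier G \<rightarrow> carrier K" "b \<in> carrier G \<rightarrow> carrier K" by auto
      have EV: "?E a \<in> carrier V"
        using Pi vV by (intro M.finsum_closed) (auto simp: Pi_iff)
      have "(\<lambda>g\<in>carrier G. c g \<odot>\<^bsub>V\<^esub> v g) \<in> (\<Pi>\<^sub>E g\<in>carrier G. Vg g)"
        if "c \<in> carrier G \<rightarrow> carrier K" for c
        using comp[OF that] by auto
      note this[OF Pi(1)] this[OF Pi(2)]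
      moreover have "?E a = (\<Oplus>\<^bsub>V\<^esub>g\<in>carrier G. (\<lambda>g\<in>carrier G. b g \<odot>\<^bsub>V\<^esub> v g) g)"
        using E_restrict[OF Pi(2)] ab(3) by simp
      ultimately have eq: "(\<lambda>g\<in>carrier G. a g \<odot>\<^bsub>V\<^esub> v g) = (\<lambda>g\<in>carrier G. b g \<odot>\<^bsub>V\<^esub> v g)"
        using direct_sum[OF EV] E_restrict[OF Pi(1)] by blast
      have "a g \<odot>\<^bsub>V\<^esub> v g = b g \<odot>\<^bsub>V\<^esub> v g" if "g \<in> carrier G" for g
        using fun_cong[OF eq, of g] that by simp
      then show "a = b"
        using smult_right_cancel[OF _ _ vV v(2)] PiE_mem[OF ab(1)] PiE_mem[OF ab(2)]
        by (intro PiE_ext[OF ab(1,2)]) blast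
    qed
    show "?E ` (carrier G \<rightarrow>\<^sub>E carrier K) = carrier V"
    proof (intro equalityI subsetI)
      fix x assume "x \<in> ?E ` (carrier G \<rightarrow>\<^sub>E carrier K)"
      then show "x \<in> carrier V"
        using vV by (auto intro!: M.finsum_closed simp: PiE_iff)
    next
      fix x assume "x \<in> carrier V"
      then obtain f where f: "f \<in> (\<Pi>\<^sub>E g\<in>carrier G. Vg g)" "x = (\<Oplus>\<^bsub>V\<^esub>g\<in>carrier G. f g)"
        using direct_sum by blast
      have "\<forall>g\<in>carrier G. \<exists>c\<in>carrier K. f g = c \<odot>\<^bsub>V\<^esub> v g"
        using component_multiple v f(1) by blast
      then obtain a where a: "\<And>g. g \<in> carrier G \<Longrightarrow> a g \<in> carrier K \<and> f g = a g \<odot>\<^bsub>V\<^esub> v g"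
        by metis
      then have "x = ?E (restrict a (carrier G))"
        unfolding f(2) using vV by (intro M.finsum_cong') auto
      then show "x \<in> ?E ` (carrier G \<rightarrow>\<^sub>E carrier K)"
        using a by auto
    qed
  qed
qed

end

section \<open>Graded isomorphisms\<close>

text \<open>Reading coordinates along \<open>v\<close> and reassembling them along \<open>w\<close>
  is a linear bijection. It respects products because, by bilinearity, these are determined by the
  common constants \<open>C\<close>.\<close>

lemma same_structure_constant_imp_graded_isomorphism:
  assumes "graded_twisted_algebra G K V Vg" and "graded_twisted_algebra G K W Wg"
    and v: "\<And>g. g \<in> carrier G \<Longrightarrow> v g \<in> Vg g" "\<And>g. g \<in> carrier G \<Longrightarrow> v g \<noteq> \<zero>\<^bsub>V\<^esub>"
    and w: "\<And>g. g \<in> carrier G \<Longrightarrow> w g \<in> Wg g" "\<And>g. g \<in> carrier G \<Longrightarrow> w g \<noteq> \<zero>\<^bsub>W\<^esub>"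
    and C: "\<And>a b. a \<in> carrier G \<Longrightarrow> b \<in> carrier G \<Longrightarrow> C a b \<in> carrier K"
    and Cv: "\<And>a b. a \<in> carrier G \<Longrightarrow> b \<in> carrier G \<Longrightarrow>
      v a \<otimes>\<^bsub>V\<^esub> v b = C a b \<odot>\<^bsub>V\<^esub> v (a \<otimes>\<^bsub>G\<^esub> b)"
    and Cw: "\<And>a b. a \<in> carrier G \<Longrightarrow> b \<in> carrier G \<Longrightarrow>
      w a \<otimes>\<^bsub>W\<^esub> w b = C a b \<odot>\<^bsub>W\<^esub> w (a \<otimes>\<^bsub>G\<^esub> b)"
  shows "\<exists>\<phi>. graded_isomorphism G K V Vg W Wg \<phi>"
proof -
  interpret V: graded_twisted_algebra G K V Vg by fact
  interpret W: graded_twisted_algebra G K W Wg by fact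
  let ?X = "carrier G \<rightarrow>\<^sub>E carrier K"
  let ?E = "\<lambda>a. \<Oplus>\<^bsub>V\<^esub>g\<in>carrier G. a g \<odot>\<^bsub>V\<^esub> v g"
  let ?F = "\<lambda>a. \<Oplus>\<^bsub>W\<^esub>g\<in>carrier G. a g \<odot>\<^bsub>W\<^esub> w g"
  have vV: "v g \<in> carrier V" and wW: "w g \<in> carrier W" if g: "g \<in> carrier G" for g
    using V.component_in_carrier[OF g v(1)[OF g]] W.component_in_carrier[OF g w(1)[OF g]] .
  have E: "bij_betw ?E ?X (carrier V)" by (rule V.homogeneous_coordinates[OF v])
  have F: "bij_betw ?F ?X (carrier W)" by (rule W.homogeneous_coordinates[OF w])
  define \<phi> where "\<phi> = (\<lambda>x. ?F (the_inv_into ?X ?E x))"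
  have bij: "bij_betw \<phi> (carrier V) (carrier W)"
    using bij_betw_trans[OF bij_betw_the_inv_into[OF E] F] unfolding \<phi>_def comp_def .
  have \<phi>E: "\<phi> (?E a) = ?F a" if "a \<in> ?X" for a
    unfolding \<phi>_def using the_inv_into_f_f[OF bij_betw_imp_inj_on[OF E] that] by simp
  have coords: "\<exists>a\<in>?X. x = ?E a" if "x \<in> carrier V" for x
    using that bij_betw_imp_surj_on[OF E] by blast
  have \<phi>W: "\<phi> x \<in> carrier W" if "x \<in> carrier V" for x
    using bij that by (rule bij_betw_apply)
  have \<phi>_add: "\<phi> (x \<oplus>\<^bsub>V\<^esub> y) = \<phi> x \<oplus>\<^bsub>W\<^esub> \<phi> y" if xy: "x \<in> carrier V" "y \<in> carrier V" for x y
  proof -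
    obtain a b where ab: "a \<in> ?X" "x = ?E a" "b \<in> ?X" "y = ?E b"
      using coords xy by blast
    \<comment> \<open>The restriction keeps the coordinatewise sum extensional, so that
      \<open>\<phi>E\<close> applies to it.\<close>
    let ?c = "\<lambda>g\<in>carrier G. a g \<oplus>\<^bsub>K\<^esub> b g"
    have c: "?c \<in> ?X" using ab by auto
    have mem: "a g \<in> carrier K" "b g \<in> carrier K" if "g \<in> carrier G" for g using ab that by auto
    have "x \<oplus>\<^bsub>V\<^esub> y = (\<Oplus>\<^bsub>V\<^esub>g\<in>carrier G. a g \<odot>\<^bsub>V\<^esub> v g \<oplus>\<^bsub>V\<^esub> b g \<odot>\<^bsub>V\<^esub> v g)"
      unfolding ab using mem vV by (intro V.M.finsum_addf[symmetric]) auto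
    also have "\<dots> = ?E ?c"
      using mem vV by (intro V.M.finsum_cong') (auto simp: V.smult_l_distr)
    finally have "\<phi> (x \<oplus>\<^bsub>V\<^esub> y) = ?F ?c" using \<phi>E[OF c] by simp
    also have "\<dots> = (\<Oplus>\<^bsub>W\<^esub>g\<in>carrier G. a g \<odot>\<^bsub>W\<^esub> w g \<oplus>\<^bsub>W\<^esub> b g \<odot>\<^bsub>W\<^esub> w g)"
      using mem wW by (intro W.M.finsum_cong') (auto simp: W.smult_l_distr)
    also have "\<dots> = ?F a \<oplus>\<^bsub>W\<^esub> ?F b"
      using mem wW by (intro W.M.finsum_addf) auto
    finally show ?thesis using \<phi>E ab by simp
  qed
  have \<phi>_smult: "\<phi> (k \<odot>\<^bsub>V\<^esub> x) = k \<odot>\<^bsub>W\<^esub> \<phi> x" if k: "k \<in> carrier K" and x: "x \<in> carrier V" for k x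
  proof -
    obtain a where a: "a \<in> ?X" "x = ?E a"
      using coords x by blast
    let ?c = "\<lambda>g\<in>carrier G. k \<otimes>\<^bsub>K\<^esub> a g"
    have c: "?c \<in> ?X" using a k by auto
    have mem: "a g \<in> carrier K" if "g \<in> carrier G" for g using a that by auto
    have "k \<odot>\<^bsub>V\<^esub> x = (\<Oplus>\<^bsub>V\<^esub>g\<in>carrier G. k \<odot>\<^bsub>V\<^esub> (a g \<odot>\<^bsub>V\<^esub> v g))"
      unfolding a using mem vV k V.finite_group by (intro V.finsum_smult_ldistr) auto
    also have "\<dots> = ?E ?c"
      using mem vV k by (intro V.M.finsum_cong') (auto simp: V.smult_assoc1)
    finally have "\<phi> (k \<odot>\<^bsub>V\<^esub> x) = ?F ?c" using \<phi>E[OF c] by simp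
    also have "\<dots> = (\<Oplus>\<^bsub>W\<^esub>g\<in>carrier G. k \<odot>\<^bsub>W\<^esub> (a g \<odot>\<^bsub>W\<^esub> w g))"
      using mem wW k by (intro W.M.finsum_cong') (auto simp: W.smult_assoc1)
    also have "\<dots> = k \<odot>\<^bsub>W\<^esub> ?F a"
      using mem wW k W.finite_group by (intro W.finsum_smult_ldistr[symmetric]) auto
    finally show ?thesis using \<phi>E a by simp
  qed
  have lin: "linear_map K V W \<phi>"
  proof (intro linear_map.intro mod_hom.intro mod_hom_axioms.intro)
    show "\<phi> \<in> module_hom K V W"
      using \<phi>W \<phi>_add \<phi>_smult by (auto simp: module_hom_def)
  qed unfold_locales
  then interpret \<phi>: linear_map K V W \<phi> .
  have \<phi>v: "\<phi> (v g) = w g" if g: "g \<in> carrier G" for g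
  proof -
    \<comment> \<open>The Kronecker delta at \<open>g\<close> gives the coordinates of both
      \<open>v g\<close> and \<open>w g\<close>.\<close>
    let ?d = "\<lambda>h\<in>carrier G. if g = h then \<one>\<^bsub>K\<^esub> else \<zero>\<^bsub>K\<^esub>"
    have "?E ?d = (\<Oplus>\<^bsub>V\<^esub>h\<in>carrier G. if g = h then v h else \<zero>\<^bsub>V\<^esub>)"
      using vV by (intro V.M.finsum_cong') auto
    also have "\<dots> = v g"
      using vV g V.finite_group by (intro V.M.finsum_singleton) auto
    finally have Ed: "?E ?d = v g" .
    have "?F ?d = (\<Oplus>\<^bsub>W\<^esub>h\<in>carrier G. if g = h then w h else \<zero>\<^bsub>W\<^esub>)"
      using wW by (intro W.M.finsum_cong') auto
    also have "\<dots> = w g"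
      using wW g W.finite_group by (intro W.M.finsum_singleton) auto
    finally have "?F ?d = w g" .
    moreover have "?d \<in> ?X" by auto
    ultimately show ?thesis using \<phi>E[of ?d] Ed by simp
  qed
  have mult_comp: "\<phi> (x \<otimes>\<^bsub>V\<^esub> y) = \<phi> x \<otimes>\<^bsub>W\<^esub> \<phi> y"
    if gh: "g \<in> carrier G" "h \<in> carrier G" and xy: "x \<in> Vg g" "y \<in> Vg h" for g h x y
  proof -
    obtain s where s: "s \<in> carrier K" "x = s \<odot>\<^bsub>V\<^esub> v g"
      using V.component_multiple[of g "v g" x] gh v xy by blast
    obtain t where t: "t \<in> carrier K" "y = t \<odot>\<^bsub>V\<^esub> v h"
      using V.component_multiple[of h "v h" y] gh v xy by blast
    have gh': "g \<otimes>\<^bsub>G\<^esub> h \<in> carrier G" using gh by simp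
    have "\<phi> (x \<otimes>\<^bsub>V\<^esub> y) = \<phi> (t \<odot>\<^bsub>V\<^esub> (s \<odot>\<^bsub>V\<^esub> (C g h \<odot>\<^bsub>V\<^esub> v (g \<otimes>\<^bsub>G\<^esub> h))))"
      using s t gh vV by (simp add: V.alg_smult_l V.alg_smult_r V.alg_closed Cv)
    also have "\<dots> = t \<odot>\<^bsub>W\<^esub> (s \<odot>\<^bsub>W\<^esub> (C g h \<odot>\<^bsub>W\<^esub> w (g \<otimes>\<^bsub>G\<^esub> h)))"
      using s(1) t(1) C[OF gh] vV[OF gh'] by (simp add: \<phi>_smult \<phi>v[OF gh'])
    also have "\<dots> = \<phi> x \<otimes>\<^bsub>W\<^esub> \<phi> y"
      using s t gh vV wW
      by (simp add: \<phi>_smult \<phi>v W.alg_smult_l W.alg_smult_r W.alg_closed Cw)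
    finally show ?thesis .
  qed
  \<comment> \<open>Absorption by zero follows from bilinearity by writing the zero vector as a
    multiple by the scalar zero. It settles the base cases of the inductions below.\<close>
  have V_zero: "\<zero>\<^bsub>V\<^esub> \<otimes>\<^bsub>V\<^esub> y = \<zero>\<^bsub>V\<^esub>" "y \<otimes>\<^bsub>V\<^esub> \<zero>\<^bsub>V\<^esub> = \<zero>\<^bsub>V\<^esub>" if "y \<in> carrier V" for y
    using that V.alg_smult_l[of "\<zero>\<^bsub>K\<^esub>" "\<zero>\<^bsub>V\<^esub>" y] V.alg_smult_r[of "\<zero>\<^bsub>K\<^esub>" y "\<zero>\<^bsub>V\<^esub>"]
    by (simp_all add: V.alg_closed)
  have W_zero: "\<zero>\<^bsub>W\<^esub> \<otimes>\<^bsub>W\<^esub> y = \<zero>\<^bsub>W\<^esub>" "y \<otimes>\<^bsub>W\<^esub> \<zero>\<^bsub>W\<^esub> = \<zero>\<^bsub>W\<^esub>" if "y \<in> carrier W" for y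
    using that W.alg_smult_l[of "\<zero>\<^bsub>K\<^esub>" "\<zero>\<^bsub>W\<^esub>" y] W.alg_smult_r[of "\<zero>\<^bsub>K\<^esub>" y "\<zero>\<^bsub>W\<^esub>"]
    by (simp_all add: W.alg_closed)
  \<comment> \<open>Two nested inductions: the left factor is first reduced to a homogeneous one,
    then the right factor, after which \<open>mult_comp\<close> applies.\<close>
  have mult: "\<phi> (x \<otimes>\<^bsub>V\<^esub> y) = \<phi> x \<otimes>\<^bsub>W\<^esub> \<phi> y" if x: "x \<in> carrier V" and y: "y \<in> carrier V" for x y
    using x
  proof (induction x rule: V.homogeneous_induct)
    case zero
    show ?case using y \<phi>W by (simp add: V_zero W_zero)
  next
    case (add x x')
    then show ?case
      using y \<phi>W by (simp add: V.alg_l_distr W.alg_l_distr \<phi>_add V.alg_closed)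
  next
    case (component g x)
    have xV: "x \<in> carrier V" using component V.component_in_carrier by blast
    show ?case using y
    proof (induction y rule: V.homogeneous_induct)
      case zero
      show ?case using xV \<phi>W by (simp add: V_zero W_zero)
    next
      case (add y y')
      then show ?case
        using xV \<phi>W by (simp add: V.alg_r_distr W.alg_r_distr \<phi>_add V.alg_closed)
    next
      case (component h y)
      then show ?case using mult_comp \<open>g \<in> carrier G\<close> \<open>x \<in> Vg g\<close> by blast
    qed
  qed
  have one: "\<phi> \<one>\<^bsub>V\<^esub> = \<one>\<^bsub>W\<^esub>"
  proof -
    have "\<one>\<^bsub>G\<^esub> \<in> carrier G" by simp
    then have oneV: "\<one>\<^bsub>V\<^esub> \<in> carrier V" and oneW: "\<one>\<^bsub>W\<^esub> \<in> carrier W"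
      using V.component_in_carrier V.one_component W.component_in_carrier W.one_component by blast+
    \<comment> \<open>The vector \<open>v \<one>\<close> may differ from the identity, so
      coordinates are avoided here. With \<open>u\<close> a preimage of the identity of
      \<open>W\<close>, the image of the identity of \<open>V\<close> equals its product with
      \<open>\<phi> u\<close>, hence \<open>\<phi> u\<close>.\<close>
    obtain u where u: "u \<in> carrier V" "\<phi> u = \<one>\<^bsub>W\<^esub>"
      using bij_betw_imp_surj_on[OF bij] oneW by (metis imageE)
    have "\<phi> \<one>\<^bsub>V\<^esub> = \<phi> \<one>\<^bsub>V\<^esub> \<otimes>\<^bsub>W\<^esub> \<phi> u"
      using u oneV \<phi>W W.r_identity by simp
    also have "\<dots> = \<one>\<^bsub>W\<^esub>"
      using mult[OF oneV u(1)] u V.l_identity by simp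
    finally show ?thesis .
  qed
  have graded: "\<phi> ` Vg g \<subseteq> Wg g" if g: "g \<in> carrier G" for g
  proof
    fix y assume "y \<in> \<phi> ` Vg g"
    then obtain x where x: "x \<in> Vg g" "y = \<phi> x" by blast
    obtain s where s: "s \<in> carrier K" "x = s \<odot>\<^bsub>V\<^esub> v g"
      using V.component_multiple[of g "v g" x] g v x by blast
    then have "y = s \<odot>\<^bsub>W\<^esub> w g" using x vV g by (simp add: \<phi>_smult \<phi>v)
    then show "y \<in> Wg g"
      using s w g by (simp add: W.component_smult_closed)
  qed
  show ?thesis
    unfolding graded_isomorphism_def using lin bij mult one graded by blast
qed

text \<open>A graded map can only rescale along each line. Multiplicativity then compares two
  multiples of the same nonzero vector \<open>w (a \<otimes> b)\<close>, and cancelling it leaves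
  the equation on scalars.\<close>

lemma graded_isomorphism_iff_rescaling:
  assumes "graded_twisted_algebra G K V Vg" and "graded_twisted_algebra G K W Wg"
    and v: "graded_basis G K V Vg v" and w: "graded_basis G K W Wg w"
    and C1: "structure_constant G K V v C1" and C2: "structure_constant G K W w C2"
  shows "(\<exists>\<phi>. graded_isomorphism G K V Vg W Wg \<phi>) \<longleftrightarrow>
    (\<exists>c \<in> carrier G \<rightarrow> Units K. \<forall>a\<in>carrier G. \<forall>b\<in>carrier G.
      C1 (a, b) \<otimes>\<^bsub>K\<^esub> c (a \<otimes>\<^bsub>G\<^esub> b) = c a \<otimes>\<^bsub>K\<^esub> c b \<otimes>\<^bsub>K\<^esub> C2 (a, b))"
    (is "?L \<longleftrightarrow> (\<exists>c\<in>_. ?R c)")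
proof -
  interpret V: graded_twisted_algebra G K V Vg by fact
  interpret W: graded_twisted_algebra G K W Wg by fact
  have vg: "v g \<in> Vg g" and wg: "w g \<in> Wg g" if "g \<in> carrier G" for g
    using that v w by (auto simp: graded_basis_def)
  have vV: "v g \<in> carrier V" and wW: "w g \<in> carrier W" if g: "g \<in> carrier G" for g
    using V.component_in_carrier[OF g vg[OF g]] W.component_in_carrier[OF g wg[OF g]] .
  have v0: "v g \<noteq> \<zero>\<^bsub>V\<^esub>" and w0: "w g \<noteq> \<zero>\<^bsub>W\<^esub>" if "g \<in> carrier G" for g
    using that V.graded_basis_nonzero[OF v] W.graded_basis_nonzero[OF w] by blast+
  have C1K: "C1 (a, b) \<in> carrier K" and C2K: "C2 (a, b) \<in> carrier K"
    if "a \<in> carrier G" "b \<in> carrier G" for a b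
  proof -
    have "C1 (a, b) \<in> Units K" "C2 (a, b) \<in> Units K"
      using that C1 C2 by (auto simp: structure_constant_def cochains2_def units_of_carrier PiE_iff)
    then show "C1 (a, b) \<in> carrier K" "C2 (a, b) \<in> carrier K"
      using V.R.Units_closed by blast+
  qed
  have C1v: "v a \<otimes>\<^bsub>V\<^esub> v b = C1 (a, b) \<odot>\<^bsub>V\<^esub> v (a \<otimes>\<^bsub>G\<^esub> b)"
    and C2w: "w a \<otimes>\<^bsub>W\<^esub> w b = C2 (a, b) \<odot>\<^bsub>W\<^esub> w (a \<otimes>\<^bsub>G\<^esub> b)"
    if "a \<in> carrier G" "b \<in> carrier G" for a b
    using that C1 C2 by (auto simp: structure_constant_def)
  have scaled: "(c a \<odot>\<^bsub>W\<^esub> w a) \<otimes>\<^bsub>W\<^esub> (c b \<odot>\<^bsub>W\<^esub> w b)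
      = (c a \<otimes>\<^bsub>K\<^esub> c b \<otimes>\<^bsub>K\<^esub> C2 (a, b)) \<odot>\<^bsub>W\<^esub> w (a \<otimes>\<^bsub>G\<^esub> b)"
    if "c a \<in> carrier K" "c b \<in> carrier K" "a \<in> carrier G" "b \<in> carrier G" for c a b
    using that wW C2K
    by (simp add: W.alg_smult_l W.alg_smult_r W.alg_closed C2w W.smult_assoc1
        V.R.m_comm[of "c a" "c b"])
  show ?thesis
  proof
    assume ?L
    then obtain \<phi> where iso: "graded_isomorphism G K V Vg W Wg \<phi>" by (rule exE)
    have lin: "linear_map K V W \<phi>" and bij: "bij_betw \<phi> (carrier V) (carrier W)"
      using iso by (simp_all add: graded_isomorphism_def)
    have mult: "\<phi> (x \<otimes>\<^bsub>V\<^esub> y) = \<phi> x \<otimes>\<^bsub>W\<^esub> \<phi> y"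
      if "x \<in> carrier V" "y \<in> carrier V" for x y
      using iso that by (simp add: graded_isomorphism_def)
    have graded: "\<phi> x \<in> Wg g" if "g \<in> carrier G" "x \<in> Vg g" for g x
      using iso that by (simp add: graded_isomorphism_def image_subset_iff)
    interpret \<phi>: linear_map K V W \<phi> by fact
    have "\<exists>c\<in>Units K. \<phi> (v g) = c \<odot>\<^bsub>W\<^esub> w g" if g: "g \<in> carrier G" for g
    proof -
      obtain c where c: "c \<in> carrier K" "\<phi> (v g) = c \<odot>\<^bsub>W\<^esub> w g"
        using W.component_multiple[OF g wg[OF g] w0[OF g] graded[OF g vg[OF g]]] by blast
      \<comment> \<open>Injectivity of \<open>\<phi>\<close> makes the scalar nonzero, hence a
        unit.\<close>
      have "\<phi> (v g) \<noteq> \<zero>\<^bsub>W\<^esub>"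
        using inj_onD[OF bij_betw_imp_inj_on[OF bij], of "v g" "\<zero>\<^bsub>V\<^esub>"] v0[OF g] vV[OF g]
        by auto
      then have "c \<noteq> \<zero>\<^bsub>K\<^esub>" using c wW[OF g] by auto
      then show ?thesis using c V.field_Units by auto
    qed
    then obtain c where c: "\<And>g. g \<in> carrier G \<Longrightarrow> c g \<in> Units K \<and> \<phi> (v g) = c g \<odot>\<^bsub>W\<^esub> w g"
      by metis
    have "?R c"
    proof (intro ballI)
      fix a b assume ab: "a \<in> carrier G" "b \<in> carrier G"
      have abG: "a \<otimes>\<^bsub>G\<^esub> b \<in> carrier G" using ab by simp
      have cK: "c g \<in> carrier K" if "g \<in> carrier G" for g using c that by blast
      \<comment> \<open>The image of \<open>v a \<otimes> v b\<close> is computed twice: by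
        linearity through \<open>C1\<close>, then by multiplicativity through
        \<open>C2\<close>.\<close>
      have "(C1 (a, b) \<otimes>\<^bsub>K\<^esub> c (a \<otimes>\<^bsub>G\<^esub> b)) \<odot>\<^bsub>W\<^esub> w (a \<otimes>\<^bsub>G\<^esub> b) = \<phi> (v a \<otimes>\<^bsub>V\<^esub> v b)"
        using c[OF abG] cK[OF abG] C1K[OF ab] vV[OF abG] wW[OF abG]
        by (simp add: C1v[OF ab] W.smult_assoc1)
      also have "\<dots> = (c a \<otimes>\<^bsub>K\<^esub> c b \<otimes>\<^bsub>K\<^esub> C2 (a, b)) \<odot>\<^bsub>W\<^esub> w (a \<otimes>\<^bsub>G\<^esub> b)"
        using ab c cK vV by (simp add: mult scaled)
      finally show "C1 (a, b) \<otimes>\<^bsub>K\<^esub> c (a \<otimes>\<^bsub>G\<^esub> b) = c a \<otimes>\<^bsub>K\<^esub> c b \<otimes>\<^bsub>K\<^esub> C2 (a, b)"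
        using W.smult_right_cancel wW[OF abG] w0[OF abG] C1K[OF ab] C2K[OF ab] cK ab abG
        by (meson V.R.m_closed)
    qed
    then show "\<exists>c\<in>carrier G \<rightarrow> Units K. ?R c" using c by blast
  next
    assume "\<exists>c\<in>carrier G \<rightarrow> Units K. ?R c"
    then obtain c where c: "c \<in> carrier G \<rightarrow> Units K" "?R c" by blast
    have cK: "c g \<in> carrier K" and c0: "c g \<noteq> \<zero>\<^bsub>K\<^esub>" if "g \<in> carrier G" for g
      using c(1) that V.field_Units by auto
    \<comment> \<open>The equation on \<open>c\<close> says exactly that the rescaled vectors
      \<open>c g \<odot> w g\<close> have structure constant \<open>C1\<close>, the same as
      \<open>v\<close>.\<close>
    show ?L
    proof (rule same_structure_constant_imp_graded_isomorphism
        [where v = v and w = "\<lambda>g. c g \<odot>\<^bsub>W\<^esub> w g" and C = "\<lambda>a b. C1 (a, b)"])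
      show "c g \<odot>\<^bsub>W\<^esub> w g \<in> Wg g" if "g \<in> carrier G" for g
        using wg cK that by (intro W.component_smult_closed) auto
      show "c g \<odot>\<^bsub>W\<^esub> w g \<noteq> \<zero>\<^bsub>W\<^esub>" if "g \<in> carrier G" for g
        using W.smult_eq_zeroD[OF cK[OF that] wW[OF that] _ w0[OF that]] c0[OF that] by blast
      show "(c a \<odot>\<^bsub>W\<^esub> w a) \<otimes>\<^bsub>W\<^esub> (c b \<odot>\<^bsub>W\<^esub> w b)
          = C1 (a, b) \<odot>\<^bsub>W\<^esub> (c (a \<otimes>\<^bsub>G\<^esub> b) \<odot>\<^bsub>W\<^esub> w (a \<otimes>\<^bsub>G\<^esub> b))"
        if "a \<in> carrier G" "b \<in> carrier G" for a b
      proof -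
        have abG: "a \<otimes>\<^bsub>G\<^esub> b \<in> carrier G" using that by simp
        have "C1 (a, b) \<odot>\<^bsub>W\<^esub> (c (a \<otimes>\<^bsub>G\<^esub> b) \<odot>\<^bsub>W\<^esub> w (a \<otimes>\<^bsub>G\<^esub> b))
            = (C1 (a, b) \<otimes>\<^bsub>K\<^esub> c (a \<otimes>\<^bsub>G\<^esub> b)) \<odot>\<^bsub>W\<^esub> w (a \<otimes>\<^bsub>G\<^esub> b)"
          using C1K[OF that] cK[OF abG] wW[OF abG] by (simp add: W.smult_assoc1)
        then show ?thesis using scaled that cK c(2) by simp
      qed
    qed (use assms(1,2) vg v0 C1K C1v in auto)
  qed
qed

section \<open>Triviality of the class and graded isomorphism\<close>

theorem theorem4:
  fixes G :: "('g, 'm) monoid_scheme"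
    and K :: "('k, 'l) ring_scheme"
    and V :: "('k, 'v, 'n) module_scheme"
    and W :: "('k, 'w, 'p) module_scheme"
    and Vg :: "'g \<Rightarrow> 'v set" and Wg :: "'g \<Rightarrow> 'w set"
    and v :: "'g \<Rightarrow> 'v" and w :: "'g \<Rightarrow> 'w"
    and C1 C2 :: "'g \<times> 'g \<Rightarrow> 'k"
  assumes "field K"
    and "group G" and "finite (carrier G)"
    and "graded_twisted_algebra G K V Vg"
    and "graded_twisted_algebra G K W Wg"
    and "graded_basis G K V Vg v"
    and "graded_basis G K W Wg w"
    and "structure_constant G K V v C1"
    and "structure_constant G K W w C2"
  shows "(\<exists>\<phi>. graded_isomorphism G K V Vg W Wg \<phi>) \<longleftrightarrow>
    (let A = units_of K;
         D = C1 \<otimes>\<^bsub>cochains2 G A\<^esub> inv\<^bsub>cochains2 G A\<^esub> C2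
     in D \<in> kernel (cochains2 G A) (cochains3 G A) (d2 G A) \<and>
        H2_class G A D = \<one>\<^bsub>H2 G A\<^esub>)"
proof -
  interpret K: field K by fact
  let ?A = "units_of K"
  have A: "comm_group ?A" by (rule K.units_comm_group)
  have C: "C1 \<in> carrier (cochains2 G ?A)" "C2 \<in> carrier (cochains2 G ?A)"
    using assms(8,9) by (simp_all add: structure_constant_def)
  \<comment> \<open>Both sides become the same rescaling equation, written once in
    \<open>units_of K\<close> and once in \<open>K\<close>; the two structures share their
    multiplication.\<close>
  show ?thesis
    unfolding Let_def trivial_class_iff_coboundary[OF assms(2) A]
      quotient_in_coboundaries2_iff[OF assms(2) A C]
      graded_isomorphism_iff_rescaling[OF assms(4-9)]
    by (simp add: units_of_carrier units_of_mult)
qed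

end
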